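(* Let $d\geq 3$ be an integer. The unital associative algebra over the polynomial ring $\mathbf{Z}[a_0,\dots,a_{d-1},\alpha,\beta]$ defined by generators $t,s$ and relations $stst=tsts$, $t^d=a_0+a_1t+\dots+a_{d-1}t^{d-1}$, $s^2=\alpha s+\beta$ is not finitely generated as a module over $\mathbf{Z}[a_0,\dots,a_{d-1},\alpha,\beta]$. *)

theory Defs
  imports "HOL-Library.Poly_Mapping" "HOL-Algebra.Module" "HOL-Algebra.QuotRing"
begin

section \<open>The polynomial ring of parameters\<close>

datatype param = Par_a nat | Par_alpha | Par_beta

text \<open>
  Polynomials over the integers in all the indeterminates of \<^typ>\<open>param\<close>: a polynomial is a finitely
  supported map from monomials to coefficients, a monomial a finitely supported map from
  indeterminates to exponents.
\<close>

type_synonym par_poly = "(param \<Rightarrow>\<^sub>0 nat) \<Rightarrow>\<^sub>0 int"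

definition par_var :: "param \<Rightarrow> par_poly"
  where "par_var v = Poly_Mapping.single (Poly_Mapping.single v 1) 1"

definition params :: "nat \<Rightarrow> param set"
  where "params d = Par_a ` {..<d} \<union> {Par_alpha, Par_beta}"

text \<open>The ring \<open>\<int>[a\<^sub>0, \<dots>, a\<^bsub>d-1\<^esub>, \<alpha>, \<beta>]\<close>.\<close>

definition par_ring :: "nat \<Rightarrow> par_poly ring"
  where "par_ring d =
    \<lparr>carrier = {p. \<forall>m \<in> Poly_Mapping.keys p. Poly_Mapping.keys m \<subseteq> params d},
     mult = (*), one = 1, zero = 0, add = (+)\<rparr>"

section \<open>The free associative algebra on two generators\<close>

text \<open>
  Lists form the free monoid, written additively here because the library multiplication on
  \<^typ>\<open>'a \<Rightarrow>\<^sub>0 'b\<close> is convolution along the addition of \<^typ>\<open>'a\<close>. Hence finitely supported maps from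
  lists over the generators to a ring form the (noncommutative) free algebra over that ring.
\<close>

instantiation list :: (type) monoid_add
begin
definition zero_list :: "'a list" where "zero_list = []"
definition plus_list :: "'a list \<Rightarrow> 'a list \<Rightarrow> 'a list" where "plus_list = (@)"
instance by standard (simp_all add: zero_list_def plus_list_def)
end

datatype gen = Gen_t | Gen_s

type_synonym free_elt = "gen list \<Rightarrow>\<^sub>0 par_poly"

definition scal :: "par_poly \<Rightarrow> free_elt"
  where "scal r = Poly_Mapping.single [] r"

definition gen_t :: free_elt
  where "gen_t = Poly_Mapping.single [Gen_t] 1"

definition gen_s :: free_elt
  where "gen_s = Poly_Mapping.single [Gen_s] 1"

definition free_alg :: "nat \<Rightarrow> (par_poly, free_elt) module"
  where "free_alg d =
    \<lparr>carrier = {f. \<forall>w. Poly_Mapping.lookup f w \<in> carrier (par_ring d)},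
     mult = (*), one = 1, zero = 0, add = (+), smult = (\<lambda>r f. scal r * f)\<rparr>"

section \<open>The presented algebra\<close>

definition relators :: "nat \<Rightarrow> free_elt set"
  where "relators d =
    {gen_s * gen_t * gen_s * gen_t - gen_t * gen_s * gen_t * gen_s,
     gen_t ^ d - (\<Sum>i<d. scal (par_var (Par_a i)) * gen_t ^ i),
     gen_s ^ 2 - (scal (par_var Par_alpha) * gen_s + scal (par_var Par_beta))}"

text \<open>
  The quotient ring \<^term>\<open>F Quot I\<close> with the induced scalar multiplication, defined on cosets in
  the same style as \<^const>\<open>rcoset_mult\<close>.
\<close>

definition quot_alg :: "('r, 'a) module \<Rightarrow> 'a set \<Rightarrow> ('r, 'a set) module"
  where "quot_alg F I =
    \<lparr>carrier = carrier (F Quot I), mult = mult (F Quot I), one = one (F Quot I),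
     zero = zero (F Quot I), add = add (F Quot I),
     smult = (\<lambda>r X. \<Union>x\<in>X. I +>\<^bsub>F\<^esub> (r \<odot>\<^bsub>F\<^esub> x))\<rparr>"

text \<open>\<^const>\<open>genideal\<close> is the two-sided ideal generated by a set.\<close>

definition presented_alg :: "nat \<Rightarrow> (par_poly, free_elt set) module"
  where "presented_alg d = quot_alg (free_alg d) (genideal (free_alg d) (relators d))"

definition finitely_generated_module :: "('r, 'm) ring_scheme \<Rightarrow> ('r, 'a, 'n) module_scheme \<Rightarrow> bool"
  where "finitely_generated_module R M \<longleftrightarrow>
    (\<exists>B. finite B \<and> B \<subseteq> carrier M \<and>
      (\<forall>x \<in> carrier M. \<exists>c \<in> B \<rightarrow> carrier R. x = (\<Oplus>\<^bsub>M\<^esub>b\<in>B. c b \<odot>\<^bsub>M\<^esub> b)))"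

section \<open>The structures above are a commutative ring, rings and modules\<close>

lemma par_ring_simps [simp]:
  "p \<in> carrier (par_ring d) \<longleftrightarrow> (\<forall>m \<in> Poly_Mapping.keys p. Poly_Mapping.keys m \<subseteq> params d)"
  "mult (par_ring d) = (*)" "one (par_ring d) = 1"
  "zero (par_ring d) = 0" "add (par_ring d) = (+)"
  by (simp_all add: par_ring_def)

lemma par_ring_closed:
  shows "0 \<in> carrier (par_ring d)" "1 \<in> carrier (par_ring d)"
    and "p \<in> carrier (par_ring d) \<Longrightarrow> q \<in> carrier (par_ring d) \<Longrightarrow> p + q \<in> carrier (par_ring d)"
    and "p \<in> carrier (par_ring d) \<Longrightarrow> q \<in> carrier (par_ring d) \<Longrightarrow> p * q \<in> carrier (par_ring d)"
    and "p \<in> carrier (par_ring d) \<Longrightarrow> - p \<in> carrier (par_ring d)"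
    and "v \<in> params d \<Longrightarrow> par_var v \<in> carrier (par_ring d)"
proof -
  show "p + q \<in> carrier (par_ring d)"
    if "p \<in> carrier (par_ring d)" "q \<in> carrier (par_ring d)"
    using that Poly_Mapping.keys_add[of p q] by auto
  show "p * q \<in> carrier (par_ring d)"
    if pq: "p \<in> carrier (par_ring d)" "q \<in> carrier (par_ring d)"
    unfolding par_ring_simps
  proof
    fix m assume "m \<in> Poly_Mapping.keys (p * q)"
    then obtain a b where "m = a + b" "a \<in> Poly_Mapping.keys p" "b \<in> Poly_Mapping.keys q"
      using keys_mult[of p q] by auto
    then show "Poly_Mapping.keys m \<subseteq> params d"
      using pq Poly_Mapping.keys_add[of a b] by (auto dest!: bspec)
  qed
qed (auto simp: par_var_def split: if_splits)

lemma par_ring_sum: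
  "(\<And>i. i \<in> A \<Longrightarrow> f i \<in> carrier (par_ring d)) \<Longrightarrow> sum f A \<in> carrier (par_ring d)"
  by (induction A rule: infinite_finite_induct) (simp_all add: par_ring_closed del: par_ring_simps(1))

lemma cring_par_ring: "cring (par_ring d)"
proof (rule cringI)
  show "abelian_group (par_ring d)"
  proof (rule abelian_groupI)
    fix x assume "x \<in> carrier (par_ring d)"
    then show "\<exists>y\<in>carrier (par_ring d). y \<oplus>\<^bsub>par_ring d\<^esub> x = \<zero>\<^bsub>par_ring d\<^esub>"
      by (intro bexI[of _ "- x"]) (simp_all add: par_ring_closed del: par_ring_simps(1))
  qed (simp_all add: par_ring_closed add_ac del: par_ring_simps(1))
  show "comm_monoid (par_ring d)"
    by (rule comm_monoidI) (simp_all add: par_ring_closed mult_ac del: par_ring_simps(1))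
qed (simp add: distrib_right)

lemma free_alg_simps [simp]:
  "f \<in> carrier (free_alg d) \<longleftrightarrow> (\<forall>w. Poly_Mapping.lookup f w \<in> carrier (par_ring d))"
  "mult (free_alg d) = (*)" "one (free_alg d) = 1"
  "zero (free_alg d) = 0" "add (free_alg d) = (+)" "smult (free_alg d) r f = scal r * f"
  by (simp_all add: free_alg_def del: par_ring_simps(1))

lemma free_alg_closed:
  shows "0 \<in> carrier (free_alg d)" "1 \<in> carrier (free_alg d)"
    and "f \<in> carrier (free_alg d) \<Longrightarrow> g \<in> carrier (free_alg d) \<Longrightarrow> f + g \<in> carrier (free_alg d)"
    and "f \<in> carrier (free_alg d) \<Longrightarrow> g \<in> carrier (free_alg d) \<Longrightarrow> f * g \<in> carrier (free_alg d)"
    and "f \<in> carrier (free_alg d) \<Longrightarrow> - f \<in> carrier (free_alg d)"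
    and "r \<in> carrier (par_ring d) \<Longrightarrow> scal r \<in> carrier (free_alg d)"
    and "gen_t \<in> carrier (free_alg d)" "gen_s \<in> carrier (free_alg d)"
proof -
  show "f * g \<in> carrier (free_alg d)"
    if "f \<in> carrier (free_alg d)" "g \<in> carrier (free_alg d)"
    using that
    by (auto simp: lookup_mult Sum_any.expand_set when_def par_ring_closed simp del: par_ring_simps(1)
        intro!: par_ring_sum par_ring_closed)
qed (auto simp: lookup_add lookup_one lookup_single when_def scal_def gen_t_def gen_s_def par_ring_closed
    simp del: par_ring_simps(1))

lemma scal_simps:
  "scal (r + r') = scal r + scal r'" "scal (r * r') = scal r * scal r'" "scal 1 = 1"
  by (simp_all add: scal_def single_add mult_single plus_list_def zero_list_def flip: single_one)

lemma lookup_scal_mult: "Poly_Mapping.lookup (scal r * f) w = r * Poly_Mapping.lookup f w"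
  and lookup_mult_scal: "Poly_Mapping.lookup (f * scal r) w = Poly_Mapping.lookup f w * r"
proof -
  have "scal r = Poly_Mapping.single 0 r" by (simp add: scal_def zero_list_def)
  then show "Poly_Mapping.lookup (scal r * f) w = r * Poly_Mapping.lookup f w"
    by (simp flip: mult_map_scale_conv_mult) (simp add: Poly_Mapping.map.rep_eq when_def)
  show "Poly_Mapping.lookup (f * scal r) w = Poly_Mapping.lookup f w * r"
  proof -
    have "(\<Sum>q. (r when [] = q) when w = l + q) = (r when w = l)" for l
    proof -
      have "((r when [] = q) when w = l + q) = ((r when w = l) when q = [])" for q
        by (auto simp: when_def plus_list_def)
      then show ?thesis by simp
    qed
    then have "Poly_Mapping.lookup (f * scal r) w = (\<Sum>l. Poly_Mapping.lookup f l * r when l = w)"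
      by (simp only: lookup_mult scal_def lookup_single mult_when eq_commute[of _ w])
    then show ?thesis by simp
  qed
qed

lemma scal_central: "f * scal r = scal r * f"
  by (rule poly_mapping_eqI) (simp add: lookup_scal_mult lookup_mult_scal mult.commute)

lemma ring_free_alg: "ring (free_alg d)"
proof (rule ringI)
  show "abelian_group (free_alg d)"
  proof (rule abelian_groupI)
    fix x assume "x \<in> carrier (free_alg d)"
    then show "\<exists>y\<in>carrier (free_alg d). y \<oplus>\<^bsub>free_alg d\<^esub> x = \<zero>\<^bsub>free_alg d\<^esub>"
      by (intro bexI[of _ "- x"]) (simp_all add: free_alg_closed del: free_alg_simps(1))
  qed (simp_all add: free_alg_closed add_ac del: free_alg_simps(1))
  show "monoid (free_alg d)"
    by (rule monoidI) (simp_all add: free_alg_closed mult.assoc del: free_alg_simps(1))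
qed (simp_all add: distrib_right distrib_left)

lemma module_free_alg: "module (par_ring d) (free_alg d)"
proof (rule moduleI)
  show "abelian_group (free_alg d)"
    using ring_free_alg by (rule ring.is_abelian_group)
qed (simp_all add: cring_par_ring free_alg_closed scal_simps distrib_left distrib_right mult.assoc
    del: free_alg_simps(1) par_ring_simps(1))

lemma free_alg_diff:
  "f \<in> carrier (free_alg d) \<Longrightarrow> g \<in> carrier (free_alg d) \<Longrightarrow> f - g \<in> carrier (free_alg d)"
  using free_alg_closed(3)[of f d "- g"] free_alg_closed(5)[of g d]
  by (simp del: free_alg_simps(1))

lemma free_alg_pow: "f \<in> carrier (free_alg d) \<Longrightarrow> f ^ n \<in> carrier (free_alg d)"
  by (induction n) (simp_all add: free_alg_closed del: free_alg_simps(1))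

lemma free_alg_sum:
  "(\<And>i. i \<in> A \<Longrightarrow> f i \<in> carrier (free_alg d)) \<Longrightarrow> sum f A \<in> carrier (free_alg d)"
  by (induction A rule: infinite_finite_induct) (simp_all add: free_alg_closed del: free_alg_simps(1))

lemma relators_closed: "relators d \<subseteq> carrier (free_alg d)"
proof -
  have "par_var (Par_a i) \<in> carrier (par_ring d)" if "i < d" for i
    using that by (intro par_ring_closed) (simp add: params_def)
  moreover have "par_var Par_alpha \<in> carrier (par_ring d)" "par_var Par_beta \<in> carrier (par_ring d)"
    by (intro par_ring_closed; simp add: params_def)+
  ultimately show ?thesis
    unfolding relators_def insert_subset
    by (intro conjI empty_subsetI free_alg_diff free_alg_sum free_alg_closed free_alg_pow)
      (simp_all only: lessThan_iff)
qed

lemma ring_quot_alg: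
  assumes "ring (F Quot I)"
  shows "ring (quot_alg F I)"
proof -
  interpret Q: ring "F Quot I" by (rule assms)
  have sel: "carrier (quot_alg F I) = carrier (F Quot I)" "mult (quot_alg F I) = mult (F Quot I)"
    "one (quot_alg F I) = one (F Quot I)" "zero (quot_alg F I) = zero (F Quot I)"
    "add (quot_alg F I) = add (F Quot I)"
    by (simp_all add: quot_alg_def)
  show ?thesis
  proof (rule ringI)
    show "abelian_group (quot_alg F I)"
      by (rule abelian_groupI; unfold sel)
        (simp_all add: Q.add.m_assoc Q.add.m_comm Q.add.m_lcomm Q.add.l_inv_ex)
    show "Group.monoid (quot_alg F I)"
      by (rule monoidI; unfold sel) (simp_all add: Q.m_assoc)
  qed (simp_all add: sel Q.l_distr Q.r_distr)
qed

lemma ring_presented_alg: "ring (presented_alg d)"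
proof -
  interpret ring "free_alg d" by (rule ring_free_alg)
  interpret I: ideal "genideal (free_alg d) (relators d)" "free_alg d"
    by (rule genideal_ideal[OF relators_closed])
  show ?thesis
    unfolding presented_alg_def by (rule ring_quot_alg[OF I.quotient_is_ring])
qed

lemma quot_alg_simps:
  "carrier (quot_alg F I) = (\<Union>x \<in> carrier F. {I +>\<^bsub>F\<^esub> x})"
  "smult (quot_alg F I) r X = (\<Union>x\<in>X. I +>\<^bsub>F\<^esub> (r \<odot>\<^bsub>F\<^esub> x))"
  by (simp_all add: quot_alg_def FactRing_def A_RCOSETS_def')

lemma presented_alg_smult:
  assumes "r \<in> carrier (par_ring d)" "f \<in> carrier (free_alg d)"
  defines "I \<equiv> genideal (free_alg d) (relators d)"
  shows "r \<odot>\<^bsub>presented_alg d\<^esub> (I +>\<^bsub>free_alg d\<^esub> f) = I +>\<^bsub>free_alg d\<^esub> (scal r * f)"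
proof -
  interpret ring "free_alg d" by (rule ring_free_alg)
  interpret I: ideal I "free_alg d"
    unfolding I_def by (rule genideal_ideal[OF relators_closed])
  have sr: "scal r \<in> carrier (free_alg d)"
    using assms(1) by (rule free_alg_closed)
  have "I +>\<^bsub>free_alg d\<^esub> (scal r * g) = I +>\<^bsub>free_alg d\<^esub> (scal r * f)"
    if g: "g \<in> I +>\<^bsub>free_alg d\<^esub> f" for g
  proof -
    obtain h where h: "h \<in> I" "g = h + f"
      using g by (auto simp: a_r_coset_def r_coset_def)
    have "scal r * h \<in> I" using I.I_l_closed[OF h(1) sr] by simp
    then have "scal r * g \<in> I +>\<^bsub>free_alg d\<^esub> (scal r * f)"
      by (auto simp: h(2) distrib_left a_r_coset_def r_coset_def)
    then show ?thesis
      by (rule a_repr_independence[OF _ free_alg_closed(4)[OF sr assms(2)] I.a_subgroup, symmetric])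
  qed
  moreover have "I +>\<^bsub>free_alg d\<^esub> f \<noteq> {}"
    using I.a_rcos_self[OF assms(2)] by blast
  ultimately have "(\<Union>g \<in> I +>\<^bsub>free_alg d\<^esub> f. I +>\<^bsub>free_alg d\<^esub> (scal r * g)) = I +>\<^bsub>free_alg d\<^esub> (scal r * f)"
    by (intro SUP_eq_const)
  then show ?thesis
    by (simp only: presented_alg_def quot_alg_simps I_def free_alg_simps(6))
qed

lemma module_presented_alg: "module (par_ring d) (presented_alg d)"
proof -
  define I where "I = genideal (free_alg d) (relators d)"
  interpret ring "free_alg d" by (rule ring_free_alg)
  interpret I: ideal I "free_alg d"
    unfolding I_def by (rule genideal_ideal[OF relators_closed])
  have "carrier (presented_alg d) = (\<Union>f \<in> carrier (free_alg d). {I +>\<^bsub>free_alg d\<^esub> f})"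
    by (simp only: presented_alg_def quot_alg_simps I_def)
  then have carr: "x \<in> carrier (presented_alg d) \<longleftrightarrow>
      (\<exists>f \<in> carrier (free_alg d). x = I +>\<^bsub>free_alg d\<^esub> f)" for x
    by (simp del: free_alg_simps(1))
  have add: "(I +>\<^bsub>free_alg d\<^esub> f) \<oplus>\<^bsub>presented_alg d\<^esub> (I +>\<^bsub>free_alg d\<^esub> g) = I +>\<^bsub>free_alg d\<^esub> (f + g)"
    if "f \<in> carrier (free_alg d)" "g \<in> carrier (free_alg d)" for f g
    using I.a_rcos_sum[OF that] by (simp add: presented_alg_def quot_alg_def FactRing_def I_def)
  note smult = presented_alg_smult[where d = d, folded I_def]
  note [simp del] = free_alg_simps(1) par_ring_simps(1)
  note [simp] = free_alg_closed par_ring_closed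
  show ?thesis
  proof (rule moduleI)
    show "abelian_group (presented_alg d)"
      using ring_presented_alg by (rule ring.is_abelian_group)
  qed (auto simp: cring_par_ring carr add smult scal_simps distrib_left distrib_right mult.assoc)
qed

end

theory Submission
  imports Defs "HOL-Library.Sublist"
begin

text \<open>
  Setting all parameters to zero turns the algebra into the monoid ring with zero given by
  \<open>stst = tsts\<close>, \<open>t\<^sup>d = 0\<close>, \<open>s\<^sup>2 = 0\<close>. Since \<open>d \<ge> 3\<close>, this ring maps onto the monomial algebra
  \<open>\<int>\<langle>s, t\<rangle> / (s\<^sup>2, t\<^sup>3, sts)\<close>, because \<open>sts\<close> occurs in both \<open>stst\<close> and \<open>tsts\<close>. A \<open>\<int>\<close>-basis of a
  monomial algebra is given by the words that contain none of the forbidden words as factors, and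
  here these include the powers \<open>(stt)\<^sup>n\<close> for all \<open>n\<close>. A quotient that is not finitely generated over
  \<open>\<int>\<close> excludes finite generation over the polynomial ring.

  The argument below uses only the coordinate functionals of this monomial algebra. For an allowed
  word \<open>w\<close>, the constant term of the coefficient at \<open>w\<close> is additive, it kills the ideal of relations
  (\<open>genideal_coord\<close>), and it turns multiplication by a scalar \<open>r\<close> into multiplication by the constant
  term of \<open>r\<close>. Finitely many elements of the free algebra involve only finitely many words, so some
  \<open>(stt)\<^sup>n\<close> has a coordinate that vanishes on all of them, hence on their span modulo the relations,
  while it is \<open>1\<close> on the class of \<open>(stt)\<^sup>n\<close> itself.
\<close>

section \<open>Words that avoid a set of factors\<close>

definition avoids :: "'a list set \<Rightarrow> 'a list \<Rightarrow> bool"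
  where "avoids F w \<longleftrightarrow> (\<forall>v\<in>F. \<not> sublist v w)"

lemma avoids_appendD:
  assumes "avoids F (u @ v)"
  shows "avoids F u" "avoids F v"
  using assms by (auto simp: avoids_def sublist_append)

definition forbidden :: "gen list set"
  where "forbidden = {[Gen_s, Gen_s], [Gen_t, Gen_t, Gen_t], [Gen_s, Gen_t, Gen_s]}"

definition stt_power :: "nat \<Rightarrow> gen list"
  where "stt_power n = concat (replicate n [Gen_s, Gen_t, Gen_t])"

lemma inj_stt_power: "inj stt_power"
proof (rule injI)
  fix m n assume "stt_power m = stt_power n"
  then have "length (stt_power m) = length (stt_power n)" by simp
  then show "m = n" by (simp add: stt_power_def length_concat sum_list_replicate)
qed

lemma avoids_stt_power: "avoids forbidden (stt_power n)"
proof (induction n)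
  case 0
  then show ?case by (simp add: avoids_def forbidden_def stt_power_def)
next
  case (Suc n)
  \<comment> \<open>A forbidden factor across the boundary of two blocks would meet the second one, whose letters
    the case distinction on \<open>n\<close> exposes.\<close>
  then show ?case
    by (cases n) (auto simp: avoids_def forbidden_def stt_power_def sublist_Cons_right)
qed

section \<open>Coordinate functionals of the specialised algebra\<close>

text \<open>The specialisation of all the indeterminates to zero.\<close>

definition const_term :: "par_poly \<Rightarrow> int"
  where "const_term p = Poly_Mapping.lookup p 0"

text \<open>
  No cancellation can occur among exponents, so only the pair of trivial monomials contributes to
  the constant term of a product.
\<close>

lemma const_term_mult: "const_term (p * q) = const_term p * const_term q"
proof -
  have zero_iff: "0 = l + k \<longleftrightarrow> l = 0 \<and> k = 0" for l k :: "param \<Rightarrow>\<^sub>0 nat"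
    by (auto simp: poly_mapping_eq_iff fun_eq_iff lookup_add)
  have "(\<Sum>k. Poly_Mapping.lookup q k when 0 = l + k) = (Poly_Mapping.lookup q 0 when l = 0)"
    for l :: "param \<Rightarrow>\<^sub>0 nat"
  proof -
    have "(Poly_Mapping.lookup q k when 0 = l + k) =
        ((Poly_Mapping.lookup q 0 when l = 0) when k = 0)" for k
      by (auto simp: when_def zero_iff)
    then show ?thesis by simp
  qed
  then show ?thesis
    by (simp add: const_term_def lookup_mult mult_when)
qed

lemma const_term_simps [simp]:
  "const_term 0 = 0" "const_term 1 = 1" "const_term (p + q) = const_term p + const_term q"
  "const_term (p - q) = const_term p - const_term q" "const_term (sum f A) = (\<Sum>a\<in>A. const_term (f a))"
  "const_term (- p) = - const_term p" "const_term (par_var v) = 0"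
  by (simp_all add: const_term_def lookup_one lookup_add lookup_minus lookup_sum par_var_def
      lookup_single when_def poly_mapping_eq_iff fun_eq_iff)

definition coord :: "gen list \<Rightarrow> free_elt \<Rightarrow> int"
  where "coord w f = const_term (Poly_Mapping.lookup f w)"

lemma coord_simps [simp]:
  "coord w 0 = 0" "coord w (f + g) = coord w f + coord w g"
  "coord w (f - g) = coord w f - coord w g" "coord w (- f) = - coord w f"
  "coord w (sum h A) = (\<Sum>a\<in>A. coord w (h a))"
  "coord w (scal r * f) = const_term r * coord w f"
  by (simp_all add: coord_def lookup_add lookup_minus lookup_sum lookup_scal_mult const_term_mult)

lemma coord_single: "coord w (Poly_Mapping.single u 1) = (if u = w then 1 else 0)"
  by (simp add: coord_def lookup_single when_def)

text \<open>
  The coefficient at \<open>w\<close> of a product collects the products of the coefficients at \<open>u\<close> and \<open>v\<close> over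
  all factorisations \<open>w = u @ v\<close>; hence it suffices that one factor has no constant terms there.
\<close>

lemma coord_mult_eq_0:
  assumes "\<And>u v. w = u @ v \<Longrightarrow> coord u f = 0 \<or> coord v g = 0"
  shows "coord w (f * g) = 0"
proof -
  have "const_term (Poly_Mapping.lookup f u *
      (\<Sum>v. Poly_Mapping.lookup g v when w = u + v)) = 0" for u
  proof (cases "const_term (Poly_Mapping.lookup f u) = 0")
    case False
    have "const_term (\<Sum>v. Poly_Mapping.lookup g v when w = u + v) = 0"
      unfolding Sum_any.expand_set const_term_simps
    proof (rule sum.neutral, rule ballI)
      fix v
      show "const_term (Poly_Mapping.lookup g v when w = u + v) = 0"
        using assms[of u v] False by (auto simp: when_def coord_def plus_list_def)
    qed
    then show ?thesis by (simp add: const_term_mult)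
  qed (simp add: const_term_mult)
  then show ?thesis
    unfolding coord_def lookup_mult Sum_any.expand_set const_term_simps
    by (intro sum.neutral) auto
qed

definition monomial_ideal :: "nat \<Rightarrow> gen list set \<Rightarrow> free_elt set"
  where "monomial_ideal d F = {f \<in> carrier (free_alg d). \<forall>w. avoids F w \<longrightarrow> coord w f = 0}"

text \<open>
  This is an ideal because every factor of a word avoiding \<open>F\<close> avoids \<open>F\<close> as well.
\<close>

lemma ideal_monomial_ideal: "ideal (monomial_ideal d F) (free_alg d)"
proof -
  interpret ring "free_alg d" by (rule ring_free_alg)
  note [simp del] = free_alg_simps(1)
  have minus: "\<ominus>\<^bsub>free_alg d\<^esub> f = - f" if "f \<in> carrier (free_alg d)" for f
    using that by (intro minus_equality) (simp_all add: free_alg_closed)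
  show ?thesis
  proof (rule idealI)
    show "subgroup (monomial_ideal d F) (add_monoid (free_alg d))"
      by (rule add.subgroupI)
        (auto simp: monomial_ideal_def free_alg_closed minus simp flip: a_inv_def)
  qed (auto simp: ring_free_alg monomial_ideal_def free_alg_closed
      intro!: coord_mult_eq_0 dest: avoids_appendD)
qed

section \<open>The relations\<close>

lemma gen_t_power: "gen_t ^ n = Poly_Mapping.single (replicate n Gen_t) 1"
proof (induction n)
  case 0
  show ?case by (simp only: power_0 replicate_0 flip: single_one zero_list_def)
next
  case (Suc n)
  then show ?case by (simp add: gen_t_def mult_single plus_list_def)
qed

lemma relators_monomial_ideal:
  assumes "d \<ge> 3"
  shows "relators d \<subseteq> monomial_ideal d forbidden"
proof
  fix f assume f: "f \<in> relators d"
  have sub: "sublist [Gen_t, Gen_t, Gen_t] (replicate d Gen_t)"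
    using assms by (auto simp: numeral_3_eq_3 le_iff_add sublist_Cons_right)
  have "coord w f = 0" if w: "avoids forbidden w" for w
  proof -
    have "w \<noteq> [Gen_s, Gen_t, Gen_s, Gen_t]" "w \<noteq> [Gen_t, Gen_s, Gen_t, Gen_s]"
      "w \<noteq> [Gen_s, Gen_s]" "w \<noteq> replicate d Gen_t"
      using w sub by (auto simp: avoids_def forbidden_def sublist_Cons_right)
    moreover have "coord w (scal (par_var v)) = 0" for v
      using coord_simps(6)[of w "par_var v" 1] by simp
    moreover have "gen_s * gen_t * gen_s * gen_t = Poly_Mapping.single [Gen_s, Gen_t, Gen_s, Gen_t] 1"
      "gen_t * gen_s * gen_t * gen_s = Poly_Mapping.single [Gen_t, Gen_s, Gen_t, Gen_s] 1"
      "gen_s ^ 2 = Poly_Mapping.single [Gen_s, Gen_s] 1"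
      by (simp_all add: gen_s_def gen_t_def mult_single plus_list_def power2_eq_square)
    ultimately show ?thesis
      using f by (auto simp: relators_def gen_t_power coord_single)
  qed
  then show "f \<in> monomial_ideal d forbidden"
    using f relators_closed[of d] by (auto simp: monomial_ideal_def simp del: free_alg_simps(1))
qed

lemma genideal_coord:
  assumes "d \<ge> 3" "avoids forbidden w" "f \<in> genideal (free_alg d) (relators d)"
  shows "coord w f = 0"
proof -
  have "genideal (free_alg d) (relators d) \<subseteq> monomial_ideal d forbidden"
    using ring.genideal_minimal[OF ring_free_alg ideal_monomial_ideal relators_monomial_ideal] assms(1)
    by blast
  then show ?thesis using assms(2,3) by (auto simp: monomial_ideal_def)
qed

section \<open>Infinite generation\<close>

theorem corollary3p7:
  fixes d :: nat
  assumes "d \<ge> 3"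
  shows "\<not> finitely_generated_module (par_ring d) (presented_alg d)"
proof
  define I where "I = genideal (free_alg d) (relators d)"
  interpret F: ring "free_alg d" by (rule ring_free_alg)
  interpret I: ideal I "free_alg d"
    unfolding I_def by (rule F.genideal_ideal[OF relators_closed])
  interpret M: module "par_ring d" "presented_alg d" by (rule module_presented_alg)
  note [simp del] = free_alg_simps(1) par_ring_simps(1)
  let ?cls = "\<lambda>f. I +>\<^bsub>free_alg d\<^esub> f"
  have carr: "carrier (presented_alg d) = ?cls ` carrier (free_alg d)"
    by (auto simp only: presented_alg_def quot_alg_simps I_def)
  have add: "?cls f \<oplus>\<^bsub>presented_alg d\<^esub> ?cls g = ?cls (f + g)"
    if "f \<in> carrier (free_alg d)" "g \<in> carrier (free_alg d)" for f g
    using I.a_rcos_sum[OF that] by (simp add: presented_alg_def quot_alg_def FactRing_def I_def)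
  have zero: "\<zero>\<^bsub>presented_alg d\<^esub> = ?cls 0"
    using F.a_coset_add_zero[OF I.a_subset] by (simp add: presented_alg_def quot_alg_def FactRing_def I_def)
  assume "finitely_generated_module (par_ring d) (presented_alg d)"
  then obtain B where B: "finite B" "B \<subseteq> carrier (presented_alg d)"
    and span: "\<And>x. x \<in> carrier (presented_alg d) \<Longrightarrow>
      \<exists>c \<in> B \<rightarrow> carrier (par_ring d). x = (\<Oplus>\<^bsub>presented_alg d\<^esub>b\<in>B. c b \<odot>\<^bsub>presented_alg d\<^esub> b)"
    by (auto simp: finitely_generated_module_def)
  obtain rep where rep: "\<And>b. b \<in> B \<Longrightarrow> rep b \<in> carrier (free_alg d) \<and> b = ?cls (rep b)"
    using B(2) unfolding carr image_def subset_iff mem_Collect_eq by metis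

  have "finite (\<Union>b\<in>B. Poly_Mapping.keys (rep b))"
    using B(1) by simp
  then obtain n where n: "stt_power n \<notin> (\<Union>b\<in>B. Poly_Mapping.keys (rep b))"
    using finite_subset[of "range stt_power"] finite_imageD[OF _ inj_stt_power] by blast
  define w where "w = stt_power n"
  define V where "V = ?cls ` {f \<in> carrier (free_alg d). coord w f = 0}"
  \<comment> \<open>Membership in \<open>V\<close> asks for one representative only, so that sums of classes can be followed
    without a choice of representatives for the partial sums.\<close>
  have V_span: "(\<Oplus>\<^bsub>presented_alg d\<^esub>b\<in>C. c b \<odot>\<^bsub>presented_alg d\<^esub> b) \<in> V"
    if "finite C" "C \<subseteq> B" "c \<in> B \<rightarrow> carrier (par_ring d)" for C c
    using that
  proof (induction C rule: finite_induct)
    case empty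
    then show ?case by (auto simp: V_def zero free_alg_closed)
  next
    case (insert b C)
    have b: "b \<in> B" and cb: "c b \<in> carrier (par_ring d)" using insert.prems by auto
    have "coord w (rep b) = 0"
      using n b by (auto simp: coord_def w_def in_keys_iff)
    moreover have "c b \<odot>\<^bsub>presented_alg d\<^esub> b = ?cls (scal (c b) * rep b)"
      using presented_alg_smult[OF cb, of "rep b"] rep[OF b] by (simp add: I_def)
    moreover obtain g where "g \<in> carrier (free_alg d)" "coord w g = 0"
      "(\<Oplus>\<^bsub>presented_alg d\<^esub>b\<in>C. c b \<odot>\<^bsub>presented_alg d\<^esub> b) = ?cls g"
      using insert by (auto simp: V_def)
    moreover have "(\<lambda>b. c b \<odot>\<^bsub>presented_alg d\<^esub> b) \<in> C \<rightarrow> carrier (presented_alg d)"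
      "c b \<odot>\<^bsub>presented_alg d\<^esub> b \<in> carrier (presented_alg d)"
      using insert.prems B(2) by (auto intro!: M.smult_closed)
    ultimately show ?case
      using insert.hyps rep[OF b] cb
      by (auto simp: M.finsum_insert add V_def free_alg_closed intro!: imageI)
  qed

  let ?x = "Poly_Mapping.single w 1"
  have x: "?x \<in> carrier (free_alg d)"
    by (auto simp: free_alg_simps(1) lookup_single when_def par_ring_closed)
  then have "?cls ?x \<in> V"
    using span[of "?cls ?x"] V_span[OF B(1) subset_refl] by (auto simp: carr)
  then obtain f where f: "f \<in> carrier (free_alg d)" "coord w f = 0" "?cls ?x = ?cls f"
    by (auto simp: V_def)
  have "?x \<in> ?cls f"
    using I.a_rcos_self[OF x] f(3) by (simp only:)
  then obtain h where h: "h \<in> I" "?x = h + f"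
    by (auto simp: a_r_coset_def r_coset_def)
  have "coord w h = 0"
    using genideal_coord[OF assms avoids_stt_power] h(1) by (simp add: I_def w_def)
  then have "coord w ?x = 0" using f(2) h(2) by simp
  then show False by (simp add: coord_single)
qed

end
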